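(* Suppose the transition kernels $P$ on the Polish space $\mathcal{X}$ satisfy the Drift Condition (with function $V$) and the Contraction Condition, both stated in the context, and let $(\mu_n)_{n\in\mathbb{Z}}$ be the associated invariant measure family described in the context. Assume the uniform finite $V$-moment $$\sup_{n\in\mathbb{N}}\int_{\mathcal{X}}V(x)\,\mu_n(dx)<\infty .$$ Let $(X_n)_{n\in\mathbb{Z}_+}$ be the time-inhomogeneous Markov chain with transition probability $P$ such that $X_0\sim\mu_0$ (consequently $X_n\sim\mu_n$ for all $n\in\mathbb{Z}_+$). Let $g:\mathcal{X}\to\mathbb{R}$ be a bounded measurable function, and write $\mu_k(g)=\int_{\mathcal{X}}g\,d\mu_k$. Then the following convergence in probability holds: $$\frac1n\sum_{k=0}^{n-1}g(X_k)-\frac1n\sum_{k=0}^{n-1}\mu_k(g)\xrightarrow[n\to\infty]{\mathbb{P}}0 .$$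
   Context: Setting. $\mathcal{X}$ is a Polish space with Borel $\sigma$-field $\mathcal{B}(\mathcal{X})$. $P$ is a family of transition probability kernels: for integers $m\le n$ and $x\in\mathcal{X}$, $P(m,x,n,\cdot)$ is a probability measure on $\mathcal{X}$ (measurable in $x$), $P(m,x,m,\cdot)=\epsilon_x$ (Dirac mass), and for all integers $m_1\le m_2\le m_3$, $x\in\mathcal{X}$, $A\in\mathcal{B}(\mathcal{X})$, the Chapman--Kolmogorov identity $P(m_1,x,m_3,A)=\int_{\mathcal{X}}P(m_1,x,m_2,dy)P(m_2,y,m_3,A)$ holds. Markov chain. A time-inhomogeneous Markov chain $(X_n)_{n\in\mathbb{Z}_+}$ with transition probability $P$ is a process with $\mathbb{P}(X_{n+1}\in A\mid X_j: j\le n)=P(n,X_n,n+1,A)$ a.s. for all $n\in\mathbb{Z}_+$ and $A\in\mathcal{B}(\mathcal{X})$. Total variation norm. For a finite signed measure, $\|\mu\|_{\mathrm{TV}}=\sup_{\|\varphi\|_\infty\le1}\left|\int\varphi\,d\mu\right|$, the supremum being over measurable $\varphi:\mathcal{X}\to\mathbb{R}$ (so the distance between two probability measures is at most $2$). Drift Condition. There is a Borel measurable $V:\mathcal{X}\to[0,\infty]$ such that (i) $\{x:V(x)<\infty\}\neq\emptyset$; (ii) there exist $0<\gamma<1$ and $C>0$ such that for all $x\in\mathcal{X}$ and $n\in\mathbb{Z}$, $\int_{\mathcal{X}}V(y)P(n-1,x,n,dy)\le\gamma V(x)+C$. Contraction Condition. For $R>0$ let $\mathcal{C}_R=\{(x,y)\in\mathcal{X}\times\mathcal{X}:V(x)+V(y)\le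 R\}$. For every $R>0$ there exist $n_0=n_0(R)\in\mathbb{N}$ and $0<\delta=\delta(R)<1$ such that for every $n\in\mathbb{Z}$, $\sup_{(x,y)\in\mathcal{C}_R}\|P(n-n_0,x,n,\cdot)-P(n-n_0,y,n,\cdot)\|_{\mathrm{TV}}\le2(1-\delta)$. Invariant measure family. By a theorem of Liu and Lu, under the Drift and Contraction Conditions there exists a unique family $(\mu_n)_{n\in\mathbb{Z}}$ of probability measures on $\mathcal{X}$ such that (a) $\mu_n(A)=\int_{\mathcal{X}}P(m,x,n,A)\,\mu_m(dx)$ for all integers $m\le n$ and $A\in\mathcal{B}(\mathcal{X})$; (b) $\int_{\mathcal{X}}V\,d\mu_n<\infty$ for every $n\in\mathbb{Z}$; (c) there exist constants $0<\alpha<1$ and $\tilde M>0$ with $\|P(n-m,x,n,\cdot)-\mu_n\|_{\mathrm{TV}}\le\tilde M\alpha^m(1+V(x))$ for all $n\in\mathbb{Z}$, $m\in\mathbb{N}$, $x\in\mathcal{X}$. This is the family meant in the claim. *)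

theory Defs
  imports "HOL-Probability.Probability"
begin

text \<open>
  Only \<open>P m x n\<close> with \<open>m \<le> n\<close> is meaningful. Membership in
  \<open>borel \<rightarrow>\<^sub>M prob_algebra borel\<close> says that every \<open>P m x n\<close> is a Borel probability
  measure and that \<open>x \<mapsto> P m x n A\<close> is measurable for every Borel set \<open>A\<close>.
\<close>

definition transition_kernels :: "(int \<Rightarrow> 'a::polish_space \<Rightarrow> int \<Rightarrow> 'a measure) \<Rightarrow> bool" where
  "transition_kernels P \<longleftrightarrow>
     (\<forall>m n. m \<le> n \<longrightarrow> (\<lambda>x. P m x n) \<in> borel \<rightarrow>\<^sub>M prob_algebra borel) \<and>
     (\<forall>m x. P m x m = return borel x) \<and>
     (\<forall>m1 m2 m3 x. \<forall>A\<in>sets borel. m1 \<le> m2 \<longrightarrow> m2 \<le> m3 \<longrightarrow>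
        emeasure (P m1 x m3) A = (\<integral>\<^sup>+y. emeasure (P m2 y m3) A \<partial>P m1 x m2))"

text \<open>
  The total variation norm of the signed measure \<open>\<mu> - \<nu>\<close>, for finite Borel measures
  \<open>\<mu>\<close> and \<open>\<nu>\<close>. There is no factor 1/2: the value for two probability measures is at most 2.
  It is \<open>ennreal\<close>-valued, so that it can be compared with bounds involving the
  possibly infinite \<open>V x\<close> and so that the supremum over the empty set is 0.
\<close>

definition tv_norm_diff :: "'a::polish_space measure \<Rightarrow> 'a measure \<Rightarrow> ennreal" where
  "tv_norm_diff \<mu> \<nu> =
     (SUP \<phi> \<in> {\<phi>. \<phi> \<in> borel_measurable borel \<and> (\<forall>x. \<bar>\<phi> x\<bar> \<le> (1::real))}.
        ennreal \<bar>(\<integral>x. \<phi> x \<partial>\<mu>) - (\<integral>x. \<phi> x \<partial>\<nu>)\<bar>)"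

definition drift_condition ::
    "(int \<Rightarrow> 'a::polish_space \<Rightarrow> int \<Rightarrow> 'a measure) \<Rightarrow> ('a \<Rightarrow> ennreal) \<Rightarrow> bool" where
  "drift_condition P V \<longleftrightarrow>
     V \<in> borel_measurable borel \<and>
     {x. V x < \<infinity>} \<noteq> {} \<and>
     (\<exists>\<gamma> C :: real. 0 < \<gamma> \<and> \<gamma> < 1 \<and> 0 < C \<and>
        (\<forall>x n. (\<integral>\<^sup>+y. V y \<partial>P (n - 1) x n) \<le> ennreal \<gamma> * V x + ennreal C))"

definition level_pairs :: "('a \<Rightarrow> ennreal) \<Rightarrow> real \<Rightarrow> ('a \<times> 'a) set" where
  "level_pairs V R = {(x, y). V x + V y \<le> ennreal R}"

definition contraction_condition ::
    "(int \<Rightarrow> 'a::polish_space \<Rightarrow> int \<Rightarrow> 'a measure) \<Rightarrow> ('a \<Rightarrow> ennreal) \<Rightarrow> bool" where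
  "contraction_condition P V \<longleftrightarrow>
     (\<forall>R::real. 0 < R \<longrightarrow>
        (\<exists>(n0::nat) (\<delta>::real). 1 \<le> n0 \<and> 0 < \<delta> \<and> \<delta> < 1 \<and>
           (\<forall>n. (SUP (x, y) \<in> level_pairs V R.
                   tv_norm_diff (P (n - int n0) x n) (P (n - int n0) y n))
                 \<le> ennreal (2 * (1 - \<delta>)))))"

text \<open>
  Under the drift and contraction conditions there is exactly one such family
  (Liu and Lu), so this predicate identifies it.
\<close>

definition invariant_measure_family ::
    "(int \<Rightarrow> 'a::polish_space \<Rightarrow> int \<Rightarrow> 'a measure) \<Rightarrow> ('a \<Rightarrow> ennreal) \<Rightarrow>
      (int \<Rightarrow> 'a measure) \<Rightarrow> bool" where
  "invariant_measure_family P V \<mu> \<longleftrightarrow>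
     (\<forall>n. \<mu> n \<in> space (prob_algebra borel)) \<and>
     (\<forall>m n. \<forall>A\<in>sets borel. m \<le> n \<longrightarrow>
        emeasure (\<mu> n) A = (\<integral>\<^sup>+x. emeasure (P m x n) A \<partial>\<mu> m)) \<and>
     (\<forall>n. (\<integral>\<^sup>+x. V x \<partial>\<mu> n) < \<infinity>) \<and>
     (\<exists>\<alpha> K :: real. 0 < \<alpha> \<and> \<alpha> < 1 \<and> 0 < K \<and>
        (\<forall>n x. \<forall>m::nat. 1 \<le> m \<longrightarrow>
           tv_norm_diff (P (n - int m) x n) (\<mu> n) \<le> ennreal (K * \<alpha> ^ m) * (1 + V x)))"

definition past_sigma :: "'w measure \<Rightarrow> (nat \<Rightarrow> 'w \<Rightarrow> 'a::topological_space) \<Rightarrow> nat \<Rightarrow> 'w measure" where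
  "past_sigma M X n =
     sigma (space M) {X j -` A \<inter> space M | j A. j \<le> n \<and> A \<in> sets borel}"

text \<open>
  \<open>real_cond_exp\<close> is the constant 0 by convention if its second argument is not a
  (sigma-finite) subalgebra; this shows that the convention is not used below.
\<close>

lemma subalgebra_past_sigma:
  assumes "\<And>j. X j \<in> M \<rightarrow>\<^sub>M borel"
  shows "subalgebra M (past_sigma M X n)"
proof -
  have sub: "{X j -` A \<inter> space M | j A. j \<le> n \<and> A \<in> sets borel} \<subseteq> Pow (space M)"
    by auto
  have "{X j -` A \<inter> space M | j A. j \<le> n \<and> A \<in> sets borel} \<subseteq> sets M"
    using measurable_sets[OF assms] by auto
  then show ?thesis
    unfolding subalgebra_def past_sigma_def sets_measure_of[OF sub]
    by (simp add: space_measure_of[OF sub] sets.sigma_sets_subset)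
qed

definition markov_chain ::
    "'w measure \<Rightarrow> (int \<Rightarrow> 'a::polish_space \<Rightarrow> int \<Rightarrow> 'a measure) \<Rightarrow> (nat \<Rightarrow> 'w \<Rightarrow> 'a) \<Rightarrow> bool" where
  "markov_chain M P X \<longleftrightarrow>
     (\<forall>n. X n \<in> M \<rightarrow>\<^sub>M borel) \<and>
     (\<forall>n. \<forall>A\<in>sets borel. AE \<omega> in M.
        real_cond_exp M (past_sigma M X n) (\<lambda>\<omega>'. indicator A (X (Suc n) \<omega>')) \<omega>
          = measure (P (int n) (X n \<omega>) (int n + 1)) A)"

definition tendsto_in_prob :: "'w measure \<Rightarrow> (nat \<Rightarrow> 'w \<Rightarrow> real) \<Rightarrow> ('w \<Rightarrow> real) \<Rightarrow> bool" where
  "tendsto_in_prob M Y Z \<longleftrightarrow>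
     (\<forall>\<epsilon>>0. (\<lambda>n. measure M {\<omega> \<in> space M. \<bar>Y n \<omega> - Z \<omega>\<bar> > \<epsilon>}) \<longlonglongrightarrow> 0)"

end

theory Submission
  imports Defs
begin

text \<open>
  The proof is a second moment estimate. Put \<open>Y\<^sub>k = g (X\<^sub>k) - \<mu>\<^sub>k(g)\<close>. Conditioning on the
  past up to time \<open>j \<le> k\<close> replaces \<open>Y\<^sub>k\<close> by
  \<open>\<integral> g dP(j, X\<^sub>j, k, \<cdot>) - \<mu>\<^sub>k(g)\<close>, which for \<open>j < k\<close> is at most
  \<open>b K \<alpha>\<^bsup>k-j\<^esup> (1 + V(X\<^sub>j))\<close> in absolute value when \<open>\<bar>g\<bar> \<le> b\<close>, by geometric convergence
  of \<open>P(j, x, k, \<cdot>)\<close> to \<open>\<mu>\<^sub>k\<close> in total variation. Since \<open>X\<^sub>j\<close> has law \<open>\<mu>\<^sub>j\<close>, whose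
  \<open>V\<close>-moment is bounded uniformly in \<open>j\<close>, the correlations satisfy
  \<open>\<bar>E[Y\<^sub>j Y\<^sub>k]\<bar> \<le> D \<alpha>\<^bsup>k-j\<^esup>\<close> for a constant \<open>D\<close>. Hence the second moment of
  \<open>Y\<^sub>0 + \<dots> + Y\<^bsub>n-1\<^esub>\<close> is at most of order \<open>n\<close>, and Chebyshev's inequality concludes
  (\<open>weak_law_decaying_correlations\<close>).

  The hypothesis on the chain only describes one-step conditional probabilities of sets. The
  identity \<open>E[W \<phi>(X\<^sub>n)] = E[W \<integral> \<phi> dP(m, X\<^sub>m, n, \<cdot>)]\<close>, for bounded \<open>W\<close> depending on
  the past up to time \<open>m\<close> (\<open>markov_chain_expectation\<close>), is obtained from it by following
  the law of \<open>X\<^sub>n\<close> under the measure with density \<open>W \<ge> 0\<close>: each step acts on this law as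
  the Giry monad's bind with the one-step kernel, and the Chapman--Kolmogorov identity composes
  the steps.
\<close>

section \<open>Transition kernels\<close>

lemma transition_kernels_measurable:
  assumes "transition_kernels P" "m \<le> n"
  shows "(\<lambda>x. P m x n) \<in> borel \<rightarrow>\<^sub>M subprob_algebra borel"
  using assms by (auto simp: transition_kernels_def intro: measurable_prob_algebraD)

lemma transition_kernels_prob_space:
  fixes P :: "int \<Rightarrow> 'a::polish_space \<Rightarrow> int \<Rightarrow> 'a measure"
  assumes "transition_kernels P" "m \<le> n"
  shows "prob_space (P m x n)" and "sets (P m x n) = sets borel"
proof -
  have "P m x n \<in> space (prob_algebra borel)"
    using assms by (auto simp: transition_kernels_def intro: measurable_space[of "\<lambda>x. P m x n" borel])
  then show "prob_space (P m x n)" "sets (P m x n) = sets borel"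
    by (auto simp: space_prob_algebra)
qed

text \<open>The Chapman--Kolmogorov identity as composition of kernels in the Giry monad.\<close>

lemma transition_kernels_bind:
  fixes P :: "int \<Rightarrow> 'a::polish_space \<Rightarrow> int \<Rightarrow> 'a measure"
  assumes P: "transition_kernels P" and le: "l \<le> m" "m \<le> n"
  shows "P l x m \<bind> (\<lambda>y. P m y n) = P l x n"
proof (rule measure_eqI)
  have sets: "sets (P l x m) = sets borel"
    using P le by (simp add: transition_kernels_prob_space)
  have kernel: "(\<lambda>y. P m y n) \<in> P l x m \<rightarrow>\<^sub>M subprob_algebra borel"
    using transition_kernels_measurable[OF P le(2)] by (simp add: measurable_cong_sets[OF sets refl])
  have ne: "space (P l x m) \<noteq> {}"
    using sets_eq_imp_space_eq[OF sets] by simp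
  show "sets (P l x m \<bind> (\<lambda>y. P m y n)) = sets (P l x n)"
    using P le ne
    by (subst sets_bind[where N=borel]) (auto simp: transition_kernels_prob_space)
  fix A assume "A \<in> sets (P l x m \<bind> (\<lambda>y. P m y n))"
  then have "A \<in> sets borel"
    using P le ne
    by (subst (asm) sets_bind[where N=borel]) (auto simp: transition_kernels_prob_space)
  then show "emeasure (P l x m \<bind> (\<lambda>y. P m y n)) A = emeasure (P l x n) A"
    using P le by (simp add: emeasure_bind[OF ne kernel] transition_kernels_def)
qed

section \<open>The Markov property over several steps\<close>

lemma past_sigma_measurable:
  fixes X :: "nat \<Rightarrow> 'w \<Rightarrow> 'a::topological_space"
  assumes "j \<le> n" "f \<in> borel \<rightarrow>\<^sub>M N"
  shows "(\<lambda>\<omega>. f (X j \<omega>)) \<in> past_sigma M X n \<rightarrow>\<^sub>M N"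
proof (rule measurable_compose[OF _ assms(2)])
  have sub: "{X j -` A \<inter> space M | j A. j \<le> n \<and> A \<in> sets borel} \<subseteq> Pow (space M)"
    by auto
  show "X j \<in> past_sigma M X n \<rightarrow>\<^sub>M borel"
  proof (rule measurableI)
    fix A :: "'a set" assume "A \<in> sets borel"
    then show "X j -` A \<inter> space (past_sigma M X n) \<in> sets (past_sigma M X n)"
      unfolding past_sigma_def sets_measure_of[OF sub] space_measure_of[OF sub]
      using assms(1) by (intro sigma_sets.Basic) auto
  qed auto
qed

lemma past_sigma_mono:
  assumes "m \<le> n" "W \<in> past_sigma M X m \<rightarrow>\<^sub>M N"
  shows "W \<in> past_sigma M X n \<rightarrow>\<^sub>M N"
proof -
  have sub: "{X j -` A \<inter> space M | j A. j \<le> k \<and> A \<in> sets borel} \<subseteq> Pow (space M)" for k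
    by auto
  have "sets (past_sigma M X m) \<subseteq> sets (past_sigma M X n)"
    unfolding past_sigma_def sets_measure_of[OF sub]
    using assms(1) by (intro sigma_sets_mono') (auto intro: order_trans)
  moreover have "space (past_sigma M X m) = space (past_sigma M X n)"
    unfolding past_sigma_def space_measure_of[OF sub] ..
  ultimately show ?thesis
    using assms(2) by (auto simp: measurable_def)
qed

text \<open>
  The one-step Markov property, tested against a nonnegative weight \<open>W\<close> depending on the past
  up to time \<open>n\<close>: under the finite measure with density \<open>W\<close>, the law of \<open>X\<^bsub>n+1\<^esub>\<close> arises from
  that of \<open>X\<^sub>n\<close> by applying the kernel.
\<close>

lemma markov_chain_weighted_law_Suc:
  fixes P :: "int \<Rightarrow> 'a::polish_space \<Rightarrow> int \<Rightarrow> 'a measure"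
  assumes "prob_space M" and P: "transition_kernels P" and chain: "markov_chain M P X"
    and W: "W \<in> borel_measurable (past_sigma M X n)"
    and bound: "\<And>\<omega>. 0 \<le> W \<omega>" "\<And>\<omega>. W \<omega> \<le> (c::real)"
  shows "distr (density M W) borel (X (Suc n))
       = distr (density M W) borel (X n) \<bind> (\<lambda>x. P (int n) x (int n + 1))"
proof -
  interpret prob_space M by fact
  have X[measurable]: "X k \<in> M \<rightarrow>\<^sub>M borel" for k
    using chain by (simp add: markov_chain_def)
  have subalg: "subalgebra M (past_sigma M X n)"
    by (rule subalgebra_past_sigma) simp
  interpret S: sigma_finite_subalgebra M "past_sigma M X n"
    by (rule finite_measure_subalgebra_is_sigma_finite, unfold_locales, rule subalg)
  have WM[measurable]: "W \<in> borel_measurable M"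
    by (rule measurable_from_subalg[OF subalg W])
  have K[measurable]: "(\<lambda>x. P (int n) x (int n + 1)) \<in> borel \<rightarrow>\<^sub>M subprob_algebra borel"
    by (rule transition_kernels_measurable[OF P]) simp
  let ?N = "distr (density M W) borel (X n)"
  have KN: "(\<lambda>x. P (int n) x (int n + 1)) \<in> ?N \<rightarrow>\<^sub>M subprob_algebra borel"
    using K by simp
  have sets: "sets (?N \<bind> (\<lambda>x. P (int n) x (int n + 1))) = sets borel"
    by (rule sets_bind) (auto simp: transition_kernels_prob_space[OF P])
  show ?thesis
  proof (rule measure_eqI)
    show "sets (distr (density M W) borel (X (Suc n)))
        = sets (?N \<bind> (\<lambda>x. P (int n) x (int n + 1)))"
      by (simp add: sets)
    fix A assume "A \<in> sets (distr (density M W) borel (X (Suc n)))"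
    then have A[measurable]: "A \<in> sets borel" by simp
    let ?I = "\<lambda>\<omega>. indicator A (X (Suc n) \<omega>) :: real"
    let ?p = "\<lambda>x. measure (P (int n) x (int n + 1)) A"
    have p01: "0 \<le> ?p x \<and> ?p x \<le> 1" for x
      using transition_kernels_prob_space(1)[OF P, of "int n" "int n + 1" x]
      by (simp add: prob_space.prob_le_1)
    have int: "integrable M (\<lambda>\<omega>. W \<omega> * ?I \<omega>)"
      by (rule integrable_const_bound[of _ c])
         (use bound in \<open>auto simp: indicator_def intro: order_trans[OF bound(1) bound(2)]\<close>)
    have intp: "integrable M (\<lambda>\<omega>. W \<omega> * ?p (X n \<omega>))"
    proof (rule integrable_const_bound[of _ c])
      show "AE \<omega> in M. norm (W \<omega> * ?p (X n \<omega>)) \<le> c"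
        proof (rule AE_I2)
        fix \<omega>
        have "W \<omega> * ?p (X n \<omega>) \<le> W \<omega>"
          using bound(1) p01 by (intro mult_left_le) auto
        then show "norm (W \<omega> * ?p (X n \<omega>)) \<le> c"
          using bound[of \<omega>] by (auto simp: abs_mult)
      qed
    qed measurable
    have "emeasure (distr (density M W) borel (X (Suc n))) A
        = (\<integral>\<^sup>+\<omega>. ennreal (W \<omega>) * indicator (X (Suc n) -` A \<inter> space M) \<omega> \<partial>M)"
      by (simp add: emeasure_distr emeasure_density)
    also have "\<dots> = (\<integral>\<^sup>+\<omega>. ennreal (W \<omega> * ?I \<omega>) \<partial>M)"
      by (intro nn_integral_cong) (auto simp: indicator_def)
    also have "\<dots> = ennreal (\<integral>\<omega>. W \<omega> * ?I \<omega> \<partial>M)"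
      using int bound by (intro nn_integral_eq_integral) auto
    also have "(\<integral>\<omega>. W \<omega> * ?I \<omega> \<partial>M)
        = (\<integral>\<omega>. W \<omega> * real_cond_exp M (past_sigma M X n) ?I \<omega> \<partial>M)"
      by (rule S.real_cond_exp_intg(2)[symmetric]) (use int W in auto)
    also have "\<dots> = (\<integral>\<omega>. W \<omega> * ?p (X n \<omega>) \<partial>M)"
    proof (rule integral_cong_AE)
      have "AE \<omega> in M. real_cond_exp M (past_sigma M X n) ?I \<omega> = ?p (X n \<omega>)"
        using chain A by (simp add: markov_chain_def)
      then show "AE \<omega> in M. W \<omega> * real_cond_exp M (past_sigma M X n) ?I \<omega> = W \<omega> * ?p (X n \<omega>)"
        by eventually_elim simp
    qed (use borel_measurable_cond_exp2 in measurable)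
    also have "ennreal \<dots> = (\<integral>\<^sup>+\<omega>. ennreal (W \<omega> * ?p (X n \<omega>)) \<partial>M)"
      using intp bound by (intro nn_integral_eq_integral[symmetric]) auto
    also have "\<dots> = (\<integral>\<^sup>+\<omega>. ennreal (W \<omega>) * emeasure (P (int n) (X n \<omega>) (int n + 1)) A \<partial>M)"
      using transition_kernels_prob_space(1)[OF P, of "int n" "int n + 1"] bound
      by (intro nn_integral_cong)
         (simp add: ennreal_mult' finite_measure.emeasure_eq_measure prob_space.finite_measure)
    also have "\<dots> = (\<integral>\<^sup>+x. emeasure (P (int n) x (int n + 1)) A \<partial>?N)"
      by (simp add: nn_integral_distr nn_integral_density)
    also have "\<dots> = emeasure (?N \<bind> (\<lambda>x. P (int n) x (int n + 1))) A"
      by (rule emeasure_bind[OF _ KN, symmetric]) auto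
    finally show "emeasure (distr (density M W) borel (X (Suc n))) A
        = emeasure (?N \<bind> (\<lambda>x. P (int n) x (int n + 1))) A" .
  qed
qed

lemma markov_chain_weighted_law:
  fixes P :: "int \<Rightarrow> 'a::polish_space \<Rightarrow> int \<Rightarrow> 'a measure"
  assumes "prob_space M" and P: "transition_kernels P" and chain: "markov_chain M P X"
    and W: "W \<in> borel_measurable (past_sigma M X m)"
    and bound: "\<And>\<omega>. 0 \<le> W \<omega>" "\<And>\<omega>. W \<omega> \<le> (c::real)"
    and le: "m \<le> n"
  shows "distr (density M W) borel (X n)
       = distr (density M W) borel (X m) \<bind> (\<lambda>x. P (int m) x (int n))"
  using le
proof (induction n rule: dec_induct)
  case base
  have "P (int m) x (int m) = return borel x" for x
    using P by (simp add: transition_kernels_def)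
  then show ?case by (simp add: bind_return'')
next
  case (step n)
  have K: "(\<lambda>x. P (int m) x (int n)) \<in> distr (density M W) borel (X m) \<rightarrow>\<^sub>M subprob_algebra borel"
    using transition_kernels_measurable[OF P, of "int m" "int n"] step by simp
  have K1: "(\<lambda>x. P (int n) x (int n + 1)) \<in> borel \<rightarrow>\<^sub>M subprob_algebra borel"
    by (rule transition_kernels_measurable[OF P]) simp
  have "distr (density M W) borel (X (Suc n))
      = distr (density M W) borel (X n) \<bind> (\<lambda>x. P (int n) x (int n + 1))"
    by (rule markov_chain_weighted_law_Suc[OF assms(1) P chain past_sigma_mono[OF step(1) W] bound])
  also have "\<dots> = distr (density M W) borel (X m) \<bind>
      (\<lambda>x. P (int m) x (int n) \<bind> (\<lambda>y. P (int n) y (int n + 1)))"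
    unfolding step.IH by (rule bind_assoc[OF K K1])
  also have "\<dots> = distr (density M W) borel (X m) \<bind> (\<lambda>x. P (int m) x (int (Suc n)))"
    using step by (simp add: transition_kernels_bind[OF P] add.commute)
  finally show ?case .
qed

text \<open>
  The Markov property over several steps for a bounded weight of arbitrary sign; it is reduced to
  nonnegative weights by adding a constant.
\<close>

lemma markov_chain_expectation:
  fixes P :: "int \<Rightarrow> 'a::polish_space \<Rightarrow> int \<Rightarrow> 'a measure" and W :: "'w \<Rightarrow> real"
  assumes "prob_space M" and P: "transition_kernels P" and chain: "markov_chain M P X"
    and W: "W \<in> borel_measurable (past_sigma M X m)" and W_bound: "\<And>\<omega>. \<bar>W \<omega>\<bar> \<le> c"
    and phi: "\<phi> \<in> borel_measurable borel" and phi_bound: "\<And>x. \<bar>\<phi> x\<bar> \<le> (b::real)"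
    and le: "m \<le> n"
  shows "(\<integral>\<omega>. W \<omega> * \<phi> (X n \<omega>) \<partial>M) = (\<integral>\<omega>. W \<omega> * (\<integral>y. \<phi> y \<partial>P (int m) (X m \<omega>) (int n)) \<partial>M)"
proof -
  interpret prob_space M by fact
  note phi[measurable]
  have X[measurable]: "X k \<in> M \<rightarrow>\<^sub>M borel" for k
    using chain by (simp add: markov_chain_def)
  have subalg: "subalgebra M (past_sigma M X m)"
    by (rule subalgebra_past_sigma) simp
  have WM[measurable]: "W \<in> borel_measurable M"
    by (rule measurable_from_subalg[OF subalg W])
  have K[measurable]: "(\<lambda>x. P (int m) x (int n)) \<in> borel \<rightarrow>\<^sub>M subprob_algebra borel"
    using le by (intro transition_kernels_measurable[OF P]) simp
  define \<psi> where "\<psi> x = (\<integral>y. \<phi> y \<partial>P (int m) x (int n))" for x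
  have psi[measurable]: "\<psi> \<in> borel_measurable borel"
    unfolding \<psi>_def by measurable
  have psi_bound: "\<bar>\<psi> x\<bar> \<le> b" for x
  proof -
    interpret Px: prob_space "P (int m) x (int n)"
      using le by (intro transition_kernels_prob_space[OF P]) simp
    have sx: "sets (P (int m) x (int n)) = sets borel"
      using le by (intro transition_kernels_prob_space[OF P]) simp
    have meas: "\<phi> \<in> borel_measurable (P (int m) x (int n))"
      using phi by (simp add: measurable_cong_sets[OF sx refl])
    have i: "integrable (P (int m) x (int n)) \<phi>"
      by (rule Px.integrable_const_bound[of _ b]) (use phi_bound meas in auto)
    have "\<bar>\<psi> x\<bar> \<le> (\<integral>y. \<bar>\<phi> y\<bar> \<partial>P (int m) x (int n))"
      unfolding \<psi>_def by (rule integral_abs_bound)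
    also have "\<dots> \<le> (\<integral>y. b \<partial>P (int m) x (int n))"
      by (intro integral_mono) (use i phi_bound in auto)
    finally show ?thesis by (simp add: Px.prob_space)
  qed
  have nonneg: "(\<integral>\<omega>. U \<omega> * \<phi> (X n \<omega>) \<partial>M) = (\<integral>\<omega>. U \<omega> * \<psi> (X m \<omega>) \<partial>M)"
    if U: "U \<in> borel_measurable (past_sigma M X m)"
      and U_bound: "\<And>\<omega>. 0 \<le> U \<omega>" "\<And>\<omega>. U \<omega> \<le> d" for U :: "'w \<Rightarrow> real" and d
  proof -
    have UM[measurable]: "U \<in> borel_measurable M"
      by (rule measurable_from_subalg[OF subalg U])
    have fin: "finite_measure (distr (density M U) borel (X m))"
    proof (rule finite_measureI)
      have "emeasure (distr (density M U) borel (X m)) UNIV = (\<integral>\<^sup>+\<omega>. ennreal (U \<omega>) \<partial>M)"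
        by (simp add: emeasure_distr emeasure_density cong: nn_integral_cong)
      also have "\<dots> \<le> (\<integral>\<^sup>+\<omega>. ennreal d \<partial>M)"
        by (intro nn_integral_mono) (use U_bound in \<open>auto intro: ennreal_leI\<close>)
      also have "\<dots> < \<infinity>"
        by (simp add: emeasure_space_1)
      finally show "emeasure (distr (density M U) borel (X m)) (space (distr (density M U) borel (X m))) \<noteq> \<infinity>"
        by simp
    qed
    have KU: "(\<lambda>x. P (int m) x (int n)) \<in> distr (density M U) borel (X m) \<rightarrow>\<^sub>M subprob_algebra borel"
      by simp
    have mass: "AE x in distr (density M U) borel (X m).
        emeasure (P (int m) x (int n)) (space (P (int m) x (int n))) \<le> ennreal 1"
      using le by (auto simp: prob_space.emeasure_space_1 transition_kernels_prob_space(1)[OF P])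
    have "(\<integral>\<omega>. U \<omega> * \<phi> (X n \<omega>) \<partial>M) = (\<integral>x. \<phi> x \<partial>distr (density M U) borel (X n))"
      using U_bound by (simp add: integral_distr integral_density)
    also have "\<dots> = (\<integral>x. \<psi> x \<partial>distr (density M U) borel (X m))"
      unfolding \<psi>_def markov_chain_weighted_law[OF assms(1) P chain U U_bound le]
      by (rule integral_bind[OF phi _ KU fin mass]) (rule phi_bound)
    also have "\<dots> = (\<integral>\<omega>. U \<omega> * \<psi> (X m \<omega>) \<partial>M)"
      using U_bound by (simp add: integral_distr integral_density)
    finally show ?thesis .
  qed
  have c0: "0 \<le> c" by (rule order_trans[OF abs_ge_zero W_bound])
  have b0: "0 \<le> b" by (rule order_trans[OF abs_ge_zero phi_bound])
  have int: "integrable M (\<lambda>\<omega>. W \<omega> * f (X k \<omega>))" "integrable M (\<lambda>\<omega>. f (X k \<omega>))"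
    if [measurable]: "f \<in> borel_measurable borel" and "\<And>x. \<bar>f x\<bar> \<le> b" for f k
  proof -
    show "integrable M (\<lambda>\<omega>. W \<omega> * f (X k \<omega>))"
      by (rule integrable_const_bound[of _ "c * b"])
         (use that W_bound c0 in \<open>auto simp: abs_mult intro!: mult_mono\<close>)
    show "integrable M (\<lambda>\<omega>. f (X k \<omega>))"
      by (rule integrable_const_bound[of _ b]) (use that in auto)
  qed
  have shift: "0 \<le> W \<omega> + c" "W \<omega> + c \<le> 2 * c" for \<omega>
    using W_bound[of \<omega>] by auto
  have "(\<integral>\<omega>. (W \<omega> + c) * \<phi> (X n \<omega>) \<partial>M) = (\<integral>\<omega>. (W \<omega> + c) * \<psi> (X m \<omega>) \<partial>M)"
    by (rule nonneg[of _ "2 * c"]) (use W shift in auto)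
  moreover have "(\<integral>\<omega>. c * \<phi> (X n \<omega>) \<partial>M) = (\<integral>\<omega>. c * \<psi> (X m \<omega>) \<partial>M)"
    by (rule nonneg[of _ c]) (use c0 in auto)
  ultimately show ?thesis
    using int[OF phi phi_bound] int[OF psi psi_bound]
    unfolding \<psi>_def[symmetric] distrib_right by auto
qed

lemma markov_chain_law:
  fixes P :: "int \<Rightarrow> 'a::polish_space \<Rightarrow> int \<Rightarrow> 'a measure"
  assumes "prob_space M" and P: "transition_kernels P" and chain: "markov_chain M P X"
    and inv: "invariant_measure_family P V \<mu>" and init: "distr M borel (X 0) = \<mu> 0"
  shows "distr M borel (X n) = \<mu> (int n)"
proof -
  interpret prob_space M by fact
  \<comment> \<open>Apply the weighted statement with the constant weight 1.\<close>
  have dens: "density M (\<lambda>_. ennreal 1) = M"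
    by (simp add: density_1)
  have mu: "sets (\<mu> k) = sets borel" "prob_space (\<mu> k)" for k
    using inv by (auto simp: invariant_measure_family_def space_prob_algebra)
  have K: "(\<lambda>x. P 0 x (int n)) \<in> \<mu> 0 \<rightarrow>\<^sub>M subprob_algebra borel"
    using transition_kernels_measurable[OF P, of 0 "int n"] by (simp add: measurable_cong_sets[OF mu(1) refl])
  have ne: "space (\<mu> 0) \<noteq> {}"
    by (rule prob_space.not_empty[OF mu(2)])
  have law: "distr M borel (X n) = \<mu> 0 \<bind> (\<lambda>x. P 0 x (int n))"
    using markov_chain_weighted_law[OF assms(1) P chain, of "\<lambda>_. 1" 0 1 n]
    unfolding dens init by simp
  show ?thesis
  proof (rule measure_eqI)
    show "sets (distr M borel (X n)) = sets (\<mu> (int n))"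
      by (simp add: mu)
    fix A assume "A \<in> sets (distr M borel (X n))"
    then have A: "A \<in> sets borel" by simp
    then show "emeasure (distr M borel (X n)) A = emeasure (\<mu> (int n)) A"
      using inv unfolding law emeasure_bind[OF ne K A] invariant_measure_family_def
      by (metis of_nat_0_le_iff)
  qed
qed

section \<open>Total variation, correlation decay and the weak law\<close>

lemma tv_norm_diff_bound:
  assumes phi: "\<phi> \<in> borel_measurable borel" and bound: "\<And>x. \<bar>\<phi> x\<bar> \<le> b" and b: "0 < (b::real)"
  shows "ennreal \<bar>(\<integral>x. \<phi> x \<partial>\<mu>) - (\<integral>x. \<phi> x \<partial>\<nu>)\<bar> \<le> ennreal b * tv_norm_diff \<mu> \<nu>"
proof -
  let ?f = "\<lambda>x. \<phi> x / b"
  have "ennreal \<bar>(\<integral>x. ?f x \<partial>\<mu>) - (\<integral>x. ?f x \<partial>\<nu>)\<bar> \<le> tv_norm_diff \<mu> \<nu>"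
    unfolding tv_norm_diff_def by (rule SUP_upper) (use assms in \<open>auto simp: divide_le_eq\<close>)
  then have "ennreal b * ennreal \<bar>(\<integral>x. ?f x \<partial>\<mu>) - (\<integral>x. ?f x \<partial>\<nu>)\<bar> \<le> ennreal b * tv_norm_diff \<mu> \<nu>"
    by (rule mult_left_mono) simp
  moreover have "b * \<bar>(\<integral>x. ?f x \<partial>\<mu>) - (\<integral>x. ?f x \<partial>\<nu>)\<bar> = \<bar>(\<integral>x. \<phi> x \<partial>\<mu>) - (\<integral>x. \<phi> x \<partial>\<nu>)\<bar>"
    using b by (simp add: diff_divide_distrib[symmetric])
  ultimately show ?thesis
    using b by (simp add: ennreal_mult'[symmetric])
qed

lemma sum_power_nat_dist_le:
  fixes \<alpha> :: real
  assumes "0 \<le> \<alpha>" "\<alpha> < 1"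
  shows "(\<Sum>k<n. \<alpha> ^ nat \<bar>int k - int j\<bar>) \<le> 2 / (1 - \<alpha>)"
proof -
  \<comment> \<open>On either side of \<open>j\<close> the exponents are distinct, so each half is part of the
    geometric series.\<close>
  have geo: "(\<Sum>i\<in>I. \<alpha> ^ i) \<le> 1 / (1 - \<alpha>)" if "finite I" for I
    using sum_le_suminf[OF _ that, of "\<lambda>i. \<alpha> ^ i"] assms
    by (simp add: suminf_geometric summable_geometric)
  have "(\<Sum>k<n. \<alpha> ^ nat \<bar>int k - int j\<bar>) = (\<Sum>k\<in>{..<n} \<inter> {..j}. \<alpha> ^ (j - k)) + (\<Sum>k\<in>{..<n} - {..j}. \<alpha> ^ (k - j))"
    by (subst sum.Int_Diff[of _ _ "{..j}"])
       (auto intro!: arg_cong2[of _ _ _ _ "(+)"] sum.cong arg_cong[of _ _ "\<lambda>i. \<alpha> ^ i"])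
  also have "(\<Sum>k\<in>{..<n} \<inter> {..j}. \<alpha> ^ (j - k)) = (\<Sum>i\<in>(\<lambda>k. j - k) ` ({..<n} \<inter> {..j}). \<alpha> ^ i)"
    by (subst sum.reindex) (auto simp: inj_on_def)
  also have "(\<Sum>k\<in>{..<n} - {..j}. \<alpha> ^ (k - j)) = (\<Sum>i\<in>(\<lambda>k. k - j) ` ({..<n} - {..j}). \<alpha> ^ i)"
    by (subst sum.reindex) (auto simp: inj_on_def)
  finally show ?thesis
    using geo[of "(\<lambda>k. j - k) ` ({..<n} \<inter> {..j})"] geo[of "(\<lambda>k. k - j) ` ({..<n} - {..j})"]
    by simp
qed

text \<open>
  No centering is assumed: the decay of the uncentered products \<open>E[Y\<^sub>j Y\<^sub>k]\<close> alone makes the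
  second moment of the partial sums at most linear in \<open>n\<close>.
\<close>

lemma weak_law_decaying_correlations:
  fixes Y :: "nat \<Rightarrow> 'w \<Rightarrow> real"
  assumes "prob_space M" and Y: "\<And>k. Y k \<in> borel_measurable M"
    and bound: "\<And>k \<omega>. \<bar>Y k \<omega>\<bar> \<le> c"
    and \<alpha>: "0 \<le> \<alpha>" "\<alpha> < 1"
    and corr: "\<And>j k. j \<le> k \<Longrightarrow> \<bar>\<integral>\<omega>. Y j \<omega> * Y k \<omega> \<partial>M\<bar> \<le> D * \<alpha> ^ (k - j)"
  shows "tendsto_in_prob M (\<lambda>n \<omega>. (1 / real n) * (\<Sum>k<n. Y k \<omega>)) (\<lambda>\<omega>. 0)"
  unfolding tendsto_in_prob_def
proof (intro allI impI)
  interpret prob_space M by fact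
  note Y[measurable]
  fix \<epsilon> :: real assume \<epsilon>: "0 < \<epsilon>"
  have c: "0 \<le> c" by (rule order_trans[OF abs_ge_zero bound])
  have D: "0 \<le> D" using order_trans[OF abs_ge_zero corr[of 0 0]] by simp
  have int: "integrable M (\<lambda>\<omega>. Y j \<omega> * Y k \<omega>)" for j k
    by (rule integrable_const_bound[of _ "c * c"])
       (use bound c in \<open>auto simp: abs_mult intro!: mult_mono\<close>)
  have corr': "(\<integral>\<omega>. Y j \<omega> * Y k \<omega> \<partial>M) \<le> D * \<alpha> ^ nat \<bar>int k - int j\<bar>" for j k
  proof (cases "j \<le> k")
    case True
    then show ?thesis using corr[of j k] by (simp add: nat_diff_distrib)
  next
    case False
    then show ?thesis using corr[of k j] by (simp add: nat_diff_distrib mult.commute[of "Y j _"])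
  qed
  define C where "C = D * (2 / (1 - \<alpha>)) / \<epsilon>\<^sup>2"
  have sq: "(\<Sum>k<n. Y k \<omega>)\<^sup>2 = (\<Sum>j<n. \<Sum>k<n. Y j \<omega> * Y k \<omega>)" for n \<omega>
    by (simp add: power2_eq_square sum_product)
  have upper: "prob {\<omega> \<in> space M. \<bar>(1 / real n) * (\<Sum>k<n. Y k \<omega>) - 0\<bar> > \<epsilon>} \<le> C * (1 / real n)" for n
  proof (cases "n = 0")
    case True
    then show ?thesis using \<epsilon> by simp
  next
    case False
    have "(\<integral>\<omega>. (\<Sum>k<n. Y k \<omega>)\<^sup>2 \<partial>M) = (\<Sum>j<n. \<Sum>k<n. \<integral>\<omega>. Y j \<omega> * Y k \<omega> \<partial>M)"
      unfolding sq by (simp add: int)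
    also have "\<dots> \<le> (\<Sum>j<n. \<Sum>k<n. D * \<alpha> ^ nat \<bar>int k - int j\<bar>)"
      by (intro sum_mono corr')
    also have "\<dots> = (\<Sum>j<n. D * (\<Sum>k<n. \<alpha> ^ nat \<bar>int k - int j\<bar>))"
      by (simp add: sum_distrib_left)
    also have "\<dots> \<le> (\<Sum>j<n. D * (2 / (1 - \<alpha>)))"
      by (intro sum_mono mult_left_mono sum_power_nat_dist_le \<alpha> D)
    finally have second_moment: "(\<integral>\<omega>. (\<Sum>k<n. Y k \<omega>)\<^sup>2 \<partial>M) \<le> real n * (D * (2 / (1 - \<alpha>)))"
      by simp
    have "prob {\<omega> \<in> space M. \<bar>(1 / real n) * (\<Sum>k<n. Y k \<omega>) - 0\<bar> > \<epsilon>}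
        \<le> prob {\<omega> \<in> space M. \<bar>\<Sum>k<n. Y k \<omega>\<bar> \<ge> real n * \<epsilon>}"
      using False by (intro finite_measure_mono) (auto simp: field_simps)
    also have "\<dots> \<le> (\<integral>\<omega>. (\<Sum>k<n. Y k \<omega>)\<^sup>2 \<partial>M) / (real n * \<epsilon>)\<^sup>2"
      by (rule second_moment_method) (use False \<epsilon> in \<open>auto simp: sq int\<close>)
    also have "\<dots> \<le> real n * (D * (2 / (1 - \<alpha>))) / (real n * \<epsilon>)\<^sup>2"
      by (intro divide_right_mono second_moment) simp
    also have "\<dots> = C * (1 / real n)"
      using False by (simp add: C_def power2_eq_square)
    finally show ?thesis .
  qed
  have limit: "(\<lambda>n. C * (1 / real n)) \<longlonglongrightarrow> 0"
    by (intro tendsto_mult_right_zero lim_1_over_n)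
  show "(\<lambda>n. prob {\<omega> \<in> space M. \<bar>(1 / real n) * (\<Sum>k<n. Y k \<omega>) - 0\<bar> > \<epsilon>}) \<longlonglongrightarrow> 0"
    by (rule tendsto_sandwich[OF _ _ tendsto_const limit])
       (use upper in \<open>simp_all only: measure_nonneg eventually_True\<close>)
qed

theorem theorem3p1:
  fixes P :: "int \<Rightarrow> 'a::polish_space \<Rightarrow> int \<Rightarrow> 'a measure"
    and V :: "'a \<Rightarrow> ennreal"
    and \<mu> :: "int \<Rightarrow> 'a measure"
    and M :: "'w measure"
    and X :: "nat \<Rightarrow> 'w \<Rightarrow> 'a"
    and g :: "'a \<Rightarrow> real"
  assumes "transition_kernels P"
    and "drift_condition P V"
    and "contraction_condition P V"
    and "invariant_measure_family P V \<mu>"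
    and "(SUP n\<in>{1::nat..}. \<integral>\<^sup>+x. V x \<partial>\<mu> (int n)) < \<infinity>"
    and "prob_space M"
    and "markov_chain M P X"
    and "distr M borel (X 0) = \<mu> 0"
    and "g \<in> borel_measurable borel"
    and "bounded (range g)"
  shows "tendsto_in_prob M
           (\<lambda>n \<omega>. (1 / real n) * (\<Sum>k<n. g (X k \<omega>))
                 - (1 / real n) * (\<Sum>k<n. \<integral>x. g x \<partial>\<mu> (int k)))
           (\<lambda>\<omega>. 0)"
proof -
  note P = assms(1) and inv = assms(4) and chain = assms(7) and g[measurable] = assms(9)
  interpret prob_space M by fact
  have X[measurable]: "X k \<in> M \<rightarrow>\<^sub>M borel" for k
    using chain by (simp add: markov_chain_def)
  have V: "V \<in> borel_measurable borel"
    using assms(2) by (simp add: drift_condition_def)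
  have mu: "sets (\<mu> k) = sets borel" "prob_space (\<mu> k)" for k
    using inv by (auto simp: invariant_measure_family_def space_prob_algebra)
  have law: "distr M borel (X n) = \<mu> (int n)" for n
    by (rule markov_chain_law[OF assms(6) P chain inv assms(8)])
  obtain b where b: "0 < b" "\<And>x. \<bar>g x\<bar> \<le> b"
    using assms(10) by (auto simp: bounded_pos)
  obtain \<alpha> K :: real where \<alpha>: "0 < \<alpha>" "\<alpha> < 1" and K: "0 < K"
    and ergodic: "\<And>n x m. 1 \<le> m \<Longrightarrow>
        tv_norm_diff (P (n - int m) x n) (\<mu> n) \<le> ennreal (K * \<alpha> ^ m) * (1 + V x)"
    using inv unfolding invariant_measure_family_def by blast
  obtain v where v: "0 \<le> v" "\<And>n::nat. (\<integral>\<^sup>+x. V x \<partial>\<mu> (int n)) \<le> ennreal v"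
  proof -
    \<comment> \<open>The uniform moment bound starts at time 1; time 0 is covered by the finiteness of each
      single moment.\<close>
    define s where "s = max (\<integral>\<^sup>+x. V x \<partial>\<mu> 0) (SUP n\<in>{1::nat..}. \<integral>\<^sup>+x. V x \<partial>\<mu> (int n))"
    have "s < \<infinity>"
      using assms(5) inv by (simp add: s_def invariant_measure_family_def)
    then obtain v where "0 \<le> v" "s = ennreal v"
      by (cases s) auto
    moreover have "(\<integral>\<^sup>+x. V x \<partial>\<mu> (int n)) \<le> s" for n
      by (cases "n = 0") (auto simp: s_def intro!: max.coboundedI2 SUP_upper2[of n])
    ultimately show ?thesis using that by auto
  qed
  define h where "h k x = g x - (\<integral>y. g y \<partial>\<mu> (int k))" for k x
  have h[measurable]: "h k \<in> borel_measurable borel" for k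
    unfolding h_def by measurable
  have mu_g: "\<bar>\<integral>y. g y \<partial>\<mu> (int k)\<bar> \<le> b" for k
  proof -
    have "\<bar>\<integral>y. g y \<partial>\<mu> (int k)\<bar> = \<bar>\<integral>\<omega>. g (X k \<omega>) \<partial>M\<bar>"
      by (simp add: law[symmetric] integral_distr)
    also have "\<dots> \<le> (\<integral>\<omega>. \<bar>g (X k \<omega>)\<bar> \<partial>M)"
      by (rule integral_abs_bound)
    also have "\<dots> \<le> (\<integral>\<omega>. b \<partial>M)"
      by (intro integral_mono integrable_abs integrable_const_bound[of _ b]) (use b in auto)
    finally show ?thesis by (simp add: prob_space)
  qed
  have h_bound: "\<bar>h k x\<bar> \<le> 2 * b" for k x
    using b(2)[of x] mu_g[of k] by (auto simp: h_def)
  define L where "L = b * K * (1 + v)"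
  have L: "0 \<le> L" using b K v by (simp add: L_def)
  have corr: "\<bar>\<integral>\<omega>. h j (X j \<omega>) * h k (X k \<omega>) \<partial>M\<bar> \<le> 2 * b * max (2 * b) L * \<alpha> ^ (k - j)"
    if "j \<le> k" for j k
  proof (cases "j = k")
    case True
    have le: "\<bar>h j (X j \<omega>) * h k (X k \<omega>)\<bar> \<le> (2 * b) * (2 * b)" for \<omega>
      unfolding abs_mult using b by (intro mult_mono h_bound) auto
    have "\<bar>\<integral>\<omega>. h j (X j \<omega>) * h k (X k \<omega>) \<partial>M\<bar> \<le> (\<integral>\<omega>. \<bar>h j (X j \<omega>) * h k (X k \<omega>)\<bar> \<partial>M)"
      by (rule integral_abs_bound)
    also have "\<dots> \<le> (\<integral>\<omega>. (2 * b) * (2 * b) \<partial>M)"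
      by (intro integral_mono integrable_abs integrable_const_bound[of _ "(2 * b) * (2 * b)"])
         (use le in auto)
    also have "\<dots> \<le> 2 * b * max (2 * b) L"
      using b by (simp add: prob_space)
    finally show ?thesis using True by simp
  next
    case False
    \<comment> \<open>The geometric rate needs at least one step, hence the separate diagonal case.\<close>
    define \<psi> where "\<psi> x = (\<integral>y. h k y \<partial>P (int j) x (int k))" for x
    have [measurable]: "(\<lambda>x. P (int j) x (int k)) \<in> borel \<rightarrow>\<^sub>M subprob_algebra borel"
      using that by (intro transition_kernels_measurable[OF P]) simp
    have psi[measurable]: "\<psi> \<in> borel_measurable borel"
      unfolding \<psi>_def by measurable
    have psi_le: "ennreal \<bar>\<psi> x\<bar> \<le> ennreal (b * K * \<alpha> ^ (k - j)) * (1 + V x)" for x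
    proof -
      interpret Px: prob_space "P (int j) x (int k)"
        using that by (intro transition_kernels_prob_space[OF P]) simp
      have sx: "sets (P (int j) x (int k)) = sets borel"
        using that by (intro transition_kernels_prob_space[OF P]) simp
      have "integrable (P (int j) x (int k)) g"
        by (rule Px.integrable_const_bound[of _ b])
           (use b g in \<open>auto simp: measurable_cong_sets[OF sx refl]\<close>)
      then have "\<psi> x = (\<integral>y. g y \<partial>P (int j) x (int k)) - (\<integral>y. g y \<partial>\<mu> (int k))"
        by (simp add: \<psi>_def h_def Px.prob_space)
      then have "ennreal \<bar>\<psi> x\<bar> \<le> ennreal b * tv_norm_diff (P (int j) x (int k)) (\<mu> (int k))"
        using tv_norm_diff_bound[OF g b(2) b(1)] by simp
      also have "\<dots> \<le> ennreal b * (ennreal (K * \<alpha> ^ (k - j)) * (1 + V x))"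
        using ergodic[of "k - j" "int k" x] that False
        by (intro mult_left_mono) auto
      also have "\<dots> = ennreal (b * K * \<alpha> ^ (k - j)) * (1 + V x)"
        using b K \<alpha> by (simp add: ennreal_mult' mult.assoc)
      finally show ?thesis .
    qed
    have "(\<integral>\<omega>. h j (X j \<omega>) * h k (X k \<omega>) \<partial>M) = (\<integral>\<omega>. h j (X j \<omega>) * \<psi> (X j \<omega>) \<partial>M)"
      unfolding \<psi>_def
      by (rule markov_chain_expectation[OF assms(6) P chain past_sigma_measurable[OF order_refl h]
            h_bound h h_bound that])
    then have "ennreal \<bar>\<integral>\<omega>. h j (X j \<omega>) * h k (X k \<omega>) \<partial>M\<bar>
        \<le> (\<integral>\<^sup>+\<omega>. ennreal \<bar>h j (X j \<omega>) * \<psi> (X j \<omega>)\<bar> \<partial>M)"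
      using integral_norm_bound_ennreal[of M "\<lambda>\<omega>. h j (X j \<omega>) * \<psi> (X j \<omega>)"]
      by (cases "integrable M (\<lambda>\<omega>. h j (X j \<omega>) * \<psi> (X j \<omega>))") (auto simp: not_integrable_integral_eq)
    also have "\<dots> \<le> (\<integral>\<^sup>+\<omega>. ennreal (2 * b) * (ennreal (b * K * \<alpha> ^ (k - j)) * (1 + V (X j \<omega>))) \<partial>M)"
    proof (rule nn_integral_mono)
      fix \<omega>
      show "ennreal \<bar>h j (X j \<omega>) * \<psi> (X j \<omega>)\<bar>
          \<le> ennreal (2 * b) * (ennreal (b * K * \<alpha> ^ (k - j)) * (1 + V (X j \<omega>)))"
        unfolding abs_mult ennreal_mult'[OF abs_ge_zero]
        by (intro mult_mono ennreal_leI h_bound psi_le) auto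
    qed
    also have "\<dots> = ennreal (2 * b) * (ennreal (b * K * \<alpha> ^ (k - j)) * (\<integral>\<^sup>+x. 1 + V x \<partial>\<mu> (int j)))"
      using V by (simp add: law[symmetric] nn_integral_distr nn_integral_cmult)
    also have "(\<integral>\<^sup>+x. 1 + V x \<partial>\<mu> (int j)) = 1 + (\<integral>\<^sup>+x. V x \<partial>\<mu> (int j))"
      using V prob_space.emeasure_space_1[OF mu(2), of "int j"]
      by (subst nn_integral_add) (auto simp: measurable_cong_sets[OF mu(1) refl])
    also have "ennreal (2 * b) * (ennreal (b * K * \<alpha> ^ (k - j)) * (1 + (\<integral>\<^sup>+x. V x \<partial>\<mu> (int j))))
        \<le> ennreal (2 * b) * (ennreal (b * K * \<alpha> ^ (k - j)) * (1 + ennreal v))"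
      by (intro mult_left_mono add_left_mono v) auto
    also have "\<dots> = ennreal (2 * b * L * \<alpha> ^ (k - j))"
      using b K \<alpha> v
      by (simp add: L_def ennreal_mult'[symmetric] ennreal_1[symmetric] ennreal_plus[symmetric] mult_ac
            del: ennreal_1 ennreal_plus)
    finally have "\<bar>\<integral>\<omega>. h j (X j \<omega>) * h k (X k \<omega>) \<partial>M\<bar> \<le> 2 * b * L * \<alpha> ^ (k - j)"
      using b L \<alpha> by (subst (asm) ennreal_le_iff) auto
    also have "\<dots> \<le> 2 * b * max (2 * b) L * \<alpha> ^ (k - j)"
      using b \<alpha> by (intro mult_right_mono mult_left_mono) auto
    finally show ?thesis .
  qed
  have "tendsto_in_prob M (\<lambda>n \<omega>. (1 / real n) * (\<Sum>k<n. h k (X k \<omega>))) (\<lambda>_. 0)"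
    by (rule weak_law_decaying_correlations[OF assms(6) _ h_bound _ \<alpha>(2) corr]) (use \<alpha> in auto)
  then show ?thesis
    by (simp add: h_def sum_subtractf right_diff_distrib)
qed

end
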